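(* For every positive integer $n$, $$\begin{aligned}T(n)=\frac14\sum_{j=1}^n\Big\{&\mathrm{Li}_2\left(\tfrac{1+i}{2}\left(1-e^{\frac{\pi i}{2n}(4j+n+1)}\right)\right)+\mathrm{Li}_2\left(\tfrac{1-i}{2}\left(1+e^{\frac{\pi i}{2n}(4j+n-1)}\right)\right)\\ &-\mathrm{Li}_2\left(\tfrac{1-i}{2}\left(1+e^{\frac{\pi i}{2n}(4j+n+1)}\right)\right)-\mathrm{Li}_2\left(\tfrac{1+i}{2}\left(1-e^{\frac{\pi i}{2n}(4j+n-1)}\right)\right)\Big\},\end{aligned}$$ and $$\begin{aligned}T\left(\frac1n\right)=\frac{\pi^2}{16}-\frac14\sum_{j=1}^n\Big\{&\mathrm{Li}_2\left(\tfrac{1+i}{2}\left(1-e^{\frac{\pi i}{2n}(4j+n+1)}\right)\right)+\mathrm{Li}_2\left(\tfrac{1-i}{2}\left(1+e^{\frac{\pi i}{2n}(4j+n-1)}\right)\right)\\ &-\mathrm{Li}_2\left(\tfrac{1-i}{2}\left(1+e^{\frac{\pi i}{2n}(4j+n+1)}\right)\right)-\mathrm{Li}_2\left(\tfrac{1+i}{2}\left(1-e^{\frac{\pi i}{2n}(4j+n-1)}\right)\right)\Big\}.\end{aligned}$$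
   Context: For $\mathrm{Re}(x)>0$, $T(x)=\int_0^1\frac{\tan^{-1}(t^x)}{1+t^2}\,dt$. $\mathrm{Li}_2(z)=\sum_{k\ge1}z^k/k^2$ for $|z|\le1$, extended analytically to $\mathbb{C}\setminus[1,\infty)$ (principal branch), with $\mathrm{Li}_2(1)=\pi^2/6$. *)

theory Defs
  imports "HOL-Complex_Analysis.Complex_Analysis"
begin

text \<open>
  Only meaningful for \<open>Re x > 0\<close>. Then \<open>0 powr x = 0\<close> is the limit value, and
  \<open>cmod (t powr x) < 1\<close> for \<open>0 \<le> t < 1\<close>, so the branch points of \<open>Arctan\<close> are avoided.
\<close>
definition T :: "complex \<Rightarrow> complex" where
  "T x = integral {0..1} (\<lambda>t::real. Arctan (complex_of_real t powr x) / complex_of_real (1 + t\<^sup>2))"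

definition dilog_series :: "complex \<Rightarrow> complex" where
  "dilog_series z = (\<Sum>k. z ^ Suc k / of_nat (Suc k) ^ 2)"

definition slit_plane :: "complex set" where
  "slit_plane = - (complex_of_real ` {1..})"

text \<open>
  The analytic continuation exists and is unique on \<open>slit_plane\<close>; see
  \<open>dilog_continuation_exists\<close> and \<open>dilog_continuation_unique\<close> below. Its value
  on the cut is arbitrary.
\<close>
definition dilog_continuation :: "complex \<Rightarrow> complex" where
  "dilog_continuation =
     (SOME f. f holomorphic_on slit_plane \<and> (\<forall>z\<in>ball 0 1. f z = dilog_series z))"

text \<open>
  The closed disc meets the cut only in the point 1, where the series gives
  \<open>pi\<^sup>2 / 6\<close>; the rest of the cut lies outside the domain of the dilogarithm,
  and \<open>Li\<^sub>2\<close> is unspecified there.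
\<close>
definition Li\<^sub>2 :: "complex \<Rightarrow> complex" where
  "Li\<^sub>2 z = (if norm z \<le> 1 then dilog_series z else dilog_continuation z)"

lemma closed_cut: "closed (complex_of_real ` {1..})"
proof -
  have "complex_of_real ` {1..} = {z. Im z = 0 \<and> 1 \<le> Re z}"
    by (auto simp: complex_eq_iff image_iff)
  moreover have "closed {z. Im z = 0 \<and> 1 \<le> Re z}"
    by (intro closed_Collect_conj closed_Collect_eq closed_Collect_le continuous_intros)
  ultimately show ?thesis by simp
qed

lemma mem_slit_plane: "z \<in> slit_plane \<longleftrightarrow> Im z \<noteq> 0 \<or> Re z < 1"
  by (auto simp: slit_plane_def complex_eq_iff image_iff)

lemma open_slit_plane: "open slit_plane"
  unfolding slit_plane_def using closed_cut by (simp add: open_Compl)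

lemma ball_subset_slit_plane: "ball 0 1 \<subseteq> slit_plane"
proof
  fix z :: complex assume "z \<in> ball 0 1"
  then have "Re z < 1" using complex_Re_le_cmod[of z] by simp
  then show "z \<in> slit_plane" by (simp add: mem_slit_plane)
qed

lemma starlike_slit_plane: "starlike slit_plane"
  unfolding starlike_def
proof (intro bexI ballI subsetI)
  show "0 \<in> slit_plane" by (simp add: mem_slit_plane)
  fix x y assume x: "x \<in> slit_plane" and "y \<in> closed_segment 0 x"
  then obtain u where u: "y = u *\<^sub>R x" "0 \<le> u" "u \<le> 1"
    by (auto simp: in_segment)
  show "y \<in> slit_plane"
  proof (cases "Im y = 0")
    case True
    then have "u = 0 \<or> Im x = 0" using u by simp
    then show ?thesis
    proof
      assume "Im x = 0"
      then have "Re x < 1" using x by (simp add: mem_slit_plane)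
      then have "u * Re x < 1"
      proof (cases "Re x \<le> 0")
        case True
        then show ?thesis using u mult_nonneg_nonpos[of u "Re x"] by linarith
      next
        case False
        then have "u * Re x \<le> Re x" using u by (simp add: mult_left_le_one_le)
        then show ?thesis using \<open>Re x < 1\<close> by linarith
      qed
      then show ?thesis using u by (simp add: mem_slit_plane)
    qed (use u in \<open>simp add: mem_slit_plane\<close>)
  qed (simp add: mem_slit_plane)
qed

lemma summable_inverse_squares: "summable (\<lambda>k. 1 / real (Suc k) ^ 2)"
  using inverse_squares_sums by (auto simp: sums_iff add.commute)

lemma dilog_series_uniform_limit:
  "uniform_limit (cball 0 1) (\<lambda>n z. \<Sum>k<n. z ^ Suc k / of_nat (Suc k) ^ 2) dilog_series sequentially"
proof -
  have "uniform_limit (cball 0 1) (\<lambda>n z. \<Sum>k<n. z ^ Suc k / of_nat (Suc k) ^ 2)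
          (\<lambda>z. \<Sum>k. z ^ Suc k / of_nat (Suc k) ^ 2 :: complex) sequentially"
  proof (rule Weierstrass_m_test[OF _ summable_inverse_squares])
    fix n :: nat and z :: complex assume "z \<in> cball 0 1"
    then have "norm (z ^ Suc n) \<le> 1"
      by (metis mem_cball_0 norm_ge_zero norm_power power_le_one)
    then show "norm (z ^ Suc n / of_nat (Suc n) ^ 2) \<le> 1 / real (Suc n) ^ 2"
      unfolding norm_divide norm_power[of "of_nat (Suc n)"] norm_of_nat
      by (intro divide_right_mono) auto
  qed
  then show ?thesis unfolding dilog_series_def .
qed

lemma continuous_on_dilog_series: "continuous_on (cball 0 1) dilog_series"
  by (rule uniform_limit_theorem[OF _ dilog_series_uniform_limit])
     (auto intro!: always_eventually continuous_intros simp del: of_nat_Suc power_Suc)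

lemma holomorphic_dilog_series: "dilog_series holomorphic_on ball 0 1"
proof (rule holomorphic_uniform_sequence[OF open_ball])
  show "(\<lambda>z. \<Sum>k<n. z ^ Suc k / of_nat (Suc k) ^ 2 :: complex) holomorphic_on ball 0 1" for n
    by (intro holomorphic_intros) (simp del: of_nat_Suc)
  fix x :: complex assume "x \<in> ball 0 1"
  then obtain d where d: "0 < d" "cball x d \<subseteq> ball 0 1"
    by (meson open_ball open_contains_cball)
  then have "cball x d \<subseteq> cball 0 1" using ball_subset_cball by blast
  then show "\<exists>d>0. cball x d \<subseteq> ball 0 1 \<and>
      uniform_limit (cball x d) (\<lambda>n z. \<Sum>k<n. z ^ Suc k / of_nat (Suc k) ^ 2) dilog_series sequentially"
    using d uniform_limit_on_subset[OF dilog_series_uniform_limit] by blast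
qed

lemma dilog_series_powser:
  assumes "norm z \<le> 1"
  shows "dilog_series z = (\<Sum>k. (1 / of_nat k ^ 2) * z ^ k)"
proof -
  have "summable (\<lambda>k. z ^ Suc k / of_nat (Suc k) ^ 2)"
  proof (rule summable_comparison_test[OF _ summable_inverse_squares], intro exI allI impI)
    fix n :: nat
    have "norm (z ^ Suc n) \<le> 1"
      by (metis assms norm_ge_zero norm_power power_le_one)
    then show "norm (z ^ Suc n / of_nat (Suc n) ^ 2) \<le> 1 / real (Suc n) ^ 2"
      unfolding norm_divide norm_power[of "of_nat (Suc n)"] norm_of_nat
      by (intro divide_right_mono) auto
  qed
  then have "(\<lambda>k. (1 / of_nat (Suc k) ^ 2) * z ^ Suc k) sums dilog_series z"
    unfolding dilog_series_def by (simp add: summable_sums del: of_nat_Suc power_Suc)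
  then have "(\<lambda>k. (1 / of_nat k ^ 2) * z ^ k) sums (dilog_series z + 1 / of_nat 0 ^ 2 * z ^ 0)"
    by (rule sums_Suc)
  then show ?thesis by (simp add: sums_iff)
qed

lemma has_field_derivative_dilog_series:
  assumes "norm z < 1" "z \<noteq> 0"
  shows "(dilog_series has_field_derivative - Ln (1 - z) / z) (at z)"
proof -
  define c :: "nat \<Rightarrow> complex" where "c = (\<lambda>k. 1 / of_nat k ^ 2)"
  have "summable (\<lambda>k. complex_of_real (1 / real (Suc k) ^ 2))"
    by (rule summable_of_real[OF summable_inverse_squares])
  then have "summable (\<lambda>k. c (Suc k) * 1 ^ Suc k)" by (simp add: c_def)
  then have "summable (\<lambda>k. c k * 1 ^ k)" by (subst (asm) summable_Suc_iff)
  then have D: "((\<lambda>z. \<Sum>k. c k * z ^ k) has_field_derivative (\<Sum>k. diffs c k * z ^ k)) (at z)"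
    by (rule termdiffs_strong) (use assms in simp)
  have "(\<lambda>k. - (z ^ k) / of_nat k) sums Ln (1 - z)"
    using Ln_series'[of "- z"] assms by simp
  then have "(\<lambda>k. - (z ^ Suc k) / of_nat (Suc k)) sums Ln (1 - z)"
    by (subst sums_Suc_iff) simp
  then have "(\<lambda>k. - (1 / z) * (- (z ^ Suc k) / of_nat (Suc k))) sums (- (1 / z) * Ln (1 - z))"
    by (rule sums_mult)
  moreover have "- (1 / z) * (- (z ^ Suc k) / of_nat (Suc k)) = diffs c k * z ^ k" for k
    using assms by (simp add: diffs_def c_def power2_eq_square del: of_nat_Suc)
  ultimately have "(\<Sum>k. diffs c k * z ^ k) = - Ln (1 - z) / z"
    by (simp add: sums_iff)
  with D have "((\<lambda>z. \<Sum>k. c k * z ^ k) has_field_derivative - Ln (1 - z) / z) (at z)" by simp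
  then show ?thesis
    by (rule has_field_derivative_transform_within_open[of _ _ _ "ball 0 1"])
       (use assms in \<open>auto simp: dilog_series_powser c_def\<close>)
qed

lemma dilog_continuation_exists:
  "\<exists>f. f holomorphic_on slit_plane \<and> (\<forall>z\<in>ball 0 1. f z = dilog_series z)"
proof -
  define l where "l = (\<lambda>z. - Ln (1 - z))"
  have l_hol: "l holomorphic_on slit_plane"
    unfolding l_def
    by (intro holomorphic_intros) (auto simp: mem_slit_plane complex_nonpos_Reals_iff)
  define g where "g = (\<lambda>z. if z = 0 then deriv l 0 else l z / z - l 0 / (z - 0))"
  have g_hol: "g holomorphic_on slit_plane"
    unfolding g_def by (rule pole_theorem_open[OF l_hol open_slit_plane]) simp
  have "\<exists>f. \<forall>z\<in>slit_plane. (f has_field_derivative g z) (at z)"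
    by (rule holomorphic_starlike_primitive[OF _ starlike_slit_plane open_slit_plane finite.emptyI])
       (use g_hol open_slit_plane in
         \<open>auto intro: holomorphic_on_imp_continuous_on holomorphic_on_imp_differentiable_at\<close>)
  then obtain f where f: "\<And>z. z \<in> slit_plane \<Longrightarrow> (f has_field_derivative g z) (at z)"
    by blast
  have f_hol: "f holomorphic_on slit_plane"
    using f holomorphic_on_open[OF open_slit_plane] by blast
  have "\<forall>z\<in>ball 0 1 - {0}. ((\<lambda>z. f z - dilog_series z) has_field_derivative 0) (at z)"
  proof
    fix z :: complex assume z: "z \<in> ball 0 1 - {0}"
    have "(f has_field_derivative - Ln (1 - z) / z) (at z)"
      using f[of z] z ball_subset_slit_plane by (auto simp: g_def l_def)
    from DERIV_diff[OF this has_field_derivative_dilog_series] z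
    show "((\<lambda>z. f z - dilog_series z) has_field_derivative 0) (at z)" by simp
  qed
  moreover have "continuous_on (ball 0 1) (\<lambda>z. f z - dilog_series z)"
    using holomorphic_on_subset[OF f_hol ball_subset_slit_plane] holomorphic_dilog_series
    by (intro continuous_on_diff holomorphic_on_imp_continuous_on)
  ultimately have "(\<lambda>z. f z - dilog_series z) constant_on ball 0 1"
    by (intro DERIV_zero_connected_constant_on[of _ "{0}"]) auto
  then obtain c where c: "\<And>z. z \<in> ball 0 1 \<Longrightarrow> f z - dilog_series z = c"
    by (auto simp: constant_on_def)
  have "(\<lambda>z. f z - c) holomorphic_on slit_plane"
    using f_hol by (intro holomorphic_intros)
  moreover have "f z - c = dilog_series z" if "z \<in> ball 0 1" for z
    using c[OF that] by (simp add: algebra_simps)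
  ultimately show ?thesis by blast
qed

lemma dilog_continuation_unique:
  assumes "f holomorphic_on slit_plane" "\<forall>z\<in>ball 0 1. f z = dilog_series z"
    and "g holomorphic_on slit_plane" "\<forall>z\<in>ball 0 1. g z = dilog_series z"
    and "z \<in> slit_plane"
  shows "f z = g z"
proof (rule analytic_continuation_open[of "ball 0 1" slit_plane f g])
  show "connected slit_plane"
    using starlike_slit_plane starlike_imp_connected by blast
qed (use assms open_slit_plane ball_subset_slit_plane in auto)

lemma
  shows holomorphic_dilog_continuation: "dilog_continuation holomorphic_on slit_plane"
    and dilog_continuation_eq_series: "z \<in> ball 0 1 \<Longrightarrow> dilog_continuation z = dilog_series z"
  using someI_ex[OF dilog_continuation_exists] unfolding dilog_continuation_def by auto

lemma Li2_eq_continuation: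
  assumes "z \<in> slit_plane"
  shows "Li\<^sub>2 z = dilog_continuation z"
proof (cases "norm z \<le> 1")
  case True
  have "norm z \<le> 1 \<Longrightarrow> dilog_series z = dilog_continuation z"
  proof -
    define u where "u = (\<lambda>n. of_real (1 - 1 / real (Suc n)) * z)"
    have u: "u \<longlonglongrightarrow> z"
    proof -
      have "(\<lambda>n. of_real (1 - 1 / real (Suc n)) * z) \<longlonglongrightarrow> of_real (1 - 0) * z"
        by (intro tendsto_intros LIMSEQ_Suc lim_1_over_n)
      then show ?thesis by (simp add: u_def)
    qed
    have ub: "u n \<in> ball 0 1" for n
    proof -
      have "norm (u n) = (1 - 1 / real (Suc n)) * norm z"
        by (simp add: u_def norm_mult del: of_real_diff of_real_divide)
      also have "\<dots> \<le> (1 - 1 / real (Suc n)) * 1"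
        using True by (intro mult_left_mono) auto
      also have "\<dots> < 1" by simp
      finally show ?thesis by simp
    qed
    have 1: "(\<lambda>n. dilog_series (u n)) \<longlonglongrightarrow> dilog_series z"
      by (rule continuous_on_tendsto_compose[OF continuous_on_dilog_series u])
         (use True ub in \<open>auto simp: less_imp_le\<close>)
    have 2: "(\<lambda>n. dilog_continuation (u n)) \<longlonglongrightarrow> dilog_continuation z"
      by (rule continuous_on_tendsto_compose
            [OF holomorphic_on_imp_continuous_on[OF holomorphic_dilog_continuation] u assms])
         (use ub ball_subset_slit_plane in \<open>blast intro: always_eventually\<close>)
    show ?thesis
      using LIMSEQ_unique[OF 1] 2 ub dilog_continuation_eq_series by simp
  qed
  then show ?thesis using True by (simp add: Li\<^sub>2_def)
qed (simp add: Li\<^sub>2_def)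

lemma holomorphic_Li2: "Li\<^sub>2 holomorphic_on slit_plane"
  using holomorphic_dilog_continuation Li2_eq_continuation
  by (simp cong: holomorphic_cong)

lemma Li2_1: "Li\<^sub>2 1 = of_real (pi\<^sup>2 / 6)"
proof -
  have "(\<lambda>k. complex_of_real (1 / real (Suc k) ^ 2)) sums of_real (pi\<^sup>2 / 6)"
    using inverse_squares_sums by (intro sums_of_real) (simp add: add.commute)
  then show ?thesis
    by (simp add: Li\<^sub>2_def dilog_series_def sums_iff)
qed

end

theory Submission
  imports Defs
begin

text \<open>
  The theorem is the evaluation of one integral with a parameter,
  \[ G(c) = \int_0^1 \frac{\mathrm{Ln}(1 - c t)}{1 + t^2}\,dt, \qquad \mathrm{Re}\,c < 1, \]
  called \<open>log_integral\<close> below. Differentiating under the integral sign leaves a rational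
  integral, and
  \[ G'(c) = \frac{\mathrm{Ln}(1 - c) - \frac{1}{2}\ln 2 + \frac{\pi}{4} c}{1 + c^2}. \]
  Because \<open>1 + c\<^sup>2 = (1 + \<i>c)(1 - \<i>c)\<close>, this is, up to a factor, the derivative of
  \<open>Li\<^sub>2 z - Li\<^sub>2 w\<close> with \<open>z = (1 - \<i>)(1 + \<i>c)/2\<close> and \<open>w = (1 + \<i>)(1 - \<i>c)/2\<close>: the numbers
  \<open>1 - z\<close> and \<open>1 - w\<close> are \<open>1 - c\<close> times the constants \<open>(1 \<plusminus> \<i>)/2\<close>, whose logarithms are
  \<open>- ln 2 / 2 \<plusminus> \<i>pi/4\<close>. Hence \<open>G\<close> is a combination of two dilogarithms up to a constant, which
  drops out of differences (\<open>log_integral_diff_eq_dilog_pair\<close>).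

  The differences come from factorizing \<open>1 \<plusminus> \<i>t\<^sup>n\<close>. If \<open>a\<close> runs over the \<open>n\<close>-th roots of \<open>\<i>\<close> and
  \<open>b\<close> over those of \<open>-\<i>\<close>, then \<open>1 + \<i>t\<^sup>n\<close> is the product of the \<open>1 - b t\<close> and \<open>1 - \<i>t\<^sup>n\<close> that of
  the \<open>1 - a t\<close>, and \<open>2\<i> arctan (t\<^sup>n)\<close> is the difference of their logarithms
  (\<open>arctan_power_eq_sum_Ln\<close>). Integrating term by term expresses \<open>T n\<close> by the differences
  \<open>G b - G a\<close>; the exponentials of the theorem are the numbers \<open>\<i>a\<close> and \<open>\<i>b\<close>. All these roots
  satisfy \<open>Re c < 1\<close>, since they lie on the unit circle and differ from 1.

  The value at \<open>1/n\<close> follows from that at \<open>n\<close> by \<open>T_reflection\<close>, which is integration by parts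
  combined with the substitution \<open>t = s\<^sup>n\<close>.
\<close>

section \<open>The derivative of the dilogarithm\<close>

text \<open>
  On the unit disc this is the termwise differentiated series. The identity
  \<open>z * deriv Li\<^sub>2 z = - Ln (1 - z)\<close>, which has no singularity at 0, then extends to the whole
  slit plane by analytic continuation.
\<close>
lemma has_field_derivative_Li2:
  assumes "z \<in> slit_plane" "z \<noteq> 0"
  shows "(Li\<^sub>2 has_field_derivative - Ln (1 - z) / z) (at z)"
proof -
  have diff: "(Li\<^sub>2 has_field_derivative deriv Li\<^sub>2 w) (at w)" if "w \<in> slit_plane" for w
    using holomorphic_derivI[OF holomorphic_Li2 open_slit_plane that] .
  have "z * deriv Li\<^sub>2 z = - Ln (1 - z)"
  proof (rule analytic_continuation_open[of "ball 0 1" slit_plane "\<lambda>w. w * deriv Li\<^sub>2 w" "\<lambda>w. - Ln (1 - w)"])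
    show "connected slit_plane"
      using starlike_slit_plane starlike_imp_connected by blast
    show "(\<lambda>w. w * deriv Li\<^sub>2 w) holomorphic_on slit_plane"
      by (intro holomorphic_intros holomorphic_deriv holomorphic_Li2 open_slit_plane)
    show "(\<lambda>w. - Ln (1 - w)) holomorphic_on slit_plane"
      by (intro holomorphic_intros) (auto simp: mem_slit_plane complex_nonpos_Reals_iff)
    fix w :: complex assume w: "w \<in> ball 0 1"
    show "w * deriv Li\<^sub>2 w = - Ln (1 - w)"
    proof (cases "w = 0")
      case False
      have "(Li\<^sub>2 has_field_derivative - Ln (1 - w) / w) (at w)"
        by (rule has_field_derivative_transform_within_open
              [OF has_field_derivative_dilog_series, of w "ball 0 1"])
           (use w False in \<open>auto simp: Li\<^sub>2_def\<close>)
      then show ?thesis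
        using False by (simp add: DERIV_imp_deriv)
    qed simp
  qed (use assms open_slit_plane ball_subset_slit_plane in auto)
  then have "deriv Li\<^sub>2 z = - Ln (1 - z) / z"
    using assms by (simp add: field_simps)
  then show ?thesis using diff[OF assms(1)] by simp
qed

lemma has_field_derivative_Li2_compose:
  assumes "(g has_field_derivative g') (at x)" "g x \<in> slit_plane" "g x \<noteq> 0"
  shows "((\<lambda>x. Li\<^sub>2 (g x)) has_field_derivative - Ln (1 - g x) / g x * g') (at x)"
  by (rule DERIV_chain2[where f = Li\<^sub>2 and g = g, OF has_field_derivative_Li2[OF assms(2,3)] assms(1)])

section \<open>A logarithmic integral with a complex parameter\<close>

text \<open>
  The half-plane \<open>Re c < 1\<close> is a convenient parameter domain: it is open and convex, it contains
  the unit circle except the point 1, and on it \<open>1 - c t\<close> stays in the right half-plane, away from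
  the cut of the logarithm.
\<close>
lemma Re_one_minus_mult_pos:
  assumes "Re c < 1" "t \<in> {0..1}"
  shows "0 < Re (1 - c * of_real t)"
proof (cases "Re c \<le> 0")
  case True
  then show ?thesis using assms mult_nonpos_nonneg[of "Re c" t] by (simp add: field_simps)
next
  case False
  then have "Re c * t \<le> Re c" using assms by (simp add: mult_left_le)
  then show ?thesis using assms by simp
qed

lemma one_minus_mult_nonzero:
  assumes "Re c < 1" "t \<in> {0..1}"
  shows "1 - c * of_real t \<notin> \<real>\<^sub>\<le>\<^sub>0" "1 - c * of_real t \<noteq> 0"
  using Re_one_minus_mult_pos[OF assms]
  by (force simp: complex_nonpos_Reals_iff)+

lemma one_plus_square_nonzero: "1 + (complex_of_real t)\<^sup>2 \<noteq> 0"
proof -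
  have "1 + t\<^sup>2 \<noteq> 0" using zero_le_power2[of t] by linarith
  then have "complex_of_real (1 + t\<^sup>2) \<noteq> 0" unfolding of_real_eq_0_iff .
  then show ?thesis by simp
qed

definition log_integral :: "complex \<Rightarrow> complex" where
  "log_integral c = integral {0..1} (\<lambda>t. Ln (1 - c * of_real t) / of_real (1 + t\<^sup>2))"

lemma log_integrand_integrable:
  assumes "Re c < 1"
  shows "(\<lambda>t. Ln (1 - c * of_real t) / of_real (1 + t\<^sup>2)) integrable_on {0..1}"
  by (intro integrable_continuous_interval continuous_intros)
     (use one_minus_mult_nonzero[OF assms] in \<open>auto simp: one_plus_square_nonzero\<close>)

lemma Ln_has_vector_derivative:
  assumes "Re c < 1" "t \<in> {0..1}"
  shows "((\<lambda>t. Ln (1 - c * of_real t)) has_vector_derivative - c / (1 - c * of_real t)) (at t within S)"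
proof -
  have "((\<lambda>z. Ln (1 - c * z)) has_field_derivative - c / (1 - c * of_real t)) (at (of_real t))"
    using one_minus_mult_nonzero[OF assms]
    by (auto intro!: derivative_eq_intros simp: divide_inverse)
  from has_vector_derivative_real_field[OF this] show ?thesis 
    by (rule has_vector_derivative_at_within)
qed

text \<open>
  Partial fractions in \<open>t\<close> give an elementary primitive. Where \<open>1 + c\<^sup>2 = 0\<close> two of the poles
  merge and the formula breaks down, although the integral is still regular there.
\<close>
lemma integral_log_integrand_deriv:
  assumes "Re c < 1" "1 + c\<^sup>2 \<noteq> 0"
  shows "integral {0..1} (\<lambda>t. - of_real t / ((1 - c * of_real t) * of_real (1 + t\<^sup>2)))
    = (Ln (1 - c) - of_real (ln 2 / 2) + c * of_real (pi / 4)) / (1 + c\<^sup>2)"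
proof -
  \<comment> \<open>The primitive comes from
    \<open>- (1 + c\<^sup>2) t / ((1 - c t) (1 + t\<^sup>2)) = - c / (1 - c t) + (c - t) / (1 + t\<^sup>2)\<close>.\<close>
  define F where "F t = (Ln (1 - c * of_real t) - of_real (ln (1 + t\<^sup>2) / 2) + c * of_real (arctan t)) / (1 + c\<^sup>2)" for t :: real
  have "((\<lambda>t. - of_real t / ((1 - c * of_real t) * of_real (1 + t\<^sup>2))) has_integral F 1 - F 0) {0..1}"
  proof (rule fundamental_theorem_of_calculus)
    fix t :: real assume t: "t \<in> {0..1}"
    have pos: "1 + t\<^sup>2 > 0" by (simp add: add_pos_nonneg)
    have 1: "((\<lambda>t. complex_of_real (ln (1 + t\<^sup>2) / 2)) has_vector_derivative of_real (t / (1 + t\<^sup>2))) (at t within {0..1})"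
      by (rule has_vector_derivative_of_real)
         (use pos in \<open>auto intro!: derivative_eq_intros simp: field_simps\<close>)
    have 2: "((\<lambda>t. complex_of_real (arctan t)) has_vector_derivative of_real (1 / (1 + t\<^sup>2))) (at t within {0..1})"
      by (rule has_vector_derivative_of_real)
         (use pos in \<open>auto intro!: derivative_eq_intros simp: field_simps\<close>)
    have "(F has_vector_derivative (- c / (1 - c * of_real t) - of_real (t / (1 + t\<^sup>2)) + c * of_real (1 / (1 + t\<^sup>2))) / (1 + c\<^sup>2)) (at t within {0..1})"
      unfolding F_def
      by (intro has_vector_derivative_divide has_vector_derivative_add has_vector_derivative_diff 
           has_vector_derivative_mult_right Ln_has_vector_derivative assms t 1 2)
    moreover have "(- c / (1 - c * of_real t) - of_real (t / (1 + t\<^sup>2)) + c * of_real (1 / (1 + t\<^sup>2))) / (1 + c\<^sup>2)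
      = - of_real t / ((1 - c * of_real t) * of_real (1 + t\<^sup>2))"
      using one_minus_mult_nonzero(2)[OF assms(1) t] one_plus_square_nonzero[of t] assms(2)
      by (simp add: divide_simps) algebra
    ultimately show "(F has_vector_derivative - of_real t / ((1 - c * of_real t) * of_real (1 + t\<^sup>2))) (at t within {0..1})"
      by simp
  qed simp
  then show ?thesis
    by (subst integral_unique) (simp_all add: F_def arctan_one)
qed

lemma log_integral_has_field_derivative:
  assumes "Re c < 1" 
  shows "(log_integral has_field_derivative 
     integral {0..1} (\<lambda>t. - of_real t / ((1 - c * of_real t) * of_real (1 + t\<^sup>2)))) (at c)"
proof -
  let ?H = "{c. Re c < 1}"
  have "((\<lambda>c. integral (cbox 0 1) (\<lambda>t. Ln (1 - c * of_real t) / of_real (1 + t\<^sup>2))) has_field_derivative 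
     integral (cbox 0 1) (\<lambda>t::real. - of_real t / ((1 - c * of_real t) * of_real (1 + t\<^sup>2)))) (at c within ?H)"
  proof (rule leibniz_rule_field_derivative)
    fix c :: complex and t :: real assume "c \<in> ?H" "t \<in> cbox 0 1"
    then show "((\<lambda>c. Ln (1 - c * of_real t) / of_real (1 + t\<^sup>2)) has_field_derivative
        - of_real t / ((1 - c * of_real t) * of_real (1 + t\<^sup>2))) (at c within ?H)"
      using one_minus_mult_nonzero[of c t] one_plus_square_nonzero[of t]
      by (auto intro!: derivative_eq_intros simp: divide_simps)
  next
    fix c assume "c \<in> ?H"
    then show "(\<lambda>t. Ln (1 - c * of_real t) / of_real (1 + t\<^sup>2)) integrable_on cbox 0 (1::real)"
      using log_integrand_integrable by simp
  next
    show "continuous_on (?H \<times> cbox 0 (1::real)) (\<lambda>(c, t). - of_real t / ((1 - c * of_real t) * of_real (1 + t\<^sup>2)))"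
      unfolding case_prod_beta
      by (intro continuous_intros)
         (auto simp: one_plus_square_nonzero dest: one_minus_mult_nonzero(2))
  qed (use assms in \<open>auto simp: convex_halfspace_Re_lt\<close>)
  moreover have "open ?H" by (rule open_halfspace_Re_lt)
  ultimately show ?thesis
    using assms by (simp add: log_integral_def[abs_def] at_within_open[of c ?H])
qed

section \<open>Evaluation of the integral by dilogarithms\<close>

definition dilog_pair :: "complex \<Rightarrow> complex" where
  "dilog_pair c = Li\<^sub>2 ((1 - \<i>) / 2 * (1 + \<i> * c)) - Li\<^sub>2 ((1 + \<i>) / 2 * (1 - \<i> * c))"

text \<open>
  Where one of these arguments is real, it equals \<open>Re c\<close>, and so is less than 1. Indeed, with \<open>c = x + \<i>y\<close>, the
  imaginary parts are \<open>(x - 1 + y)/2\<close> and \<open>(1 - x + y)/2\<close>, and where they vanish the real part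
  equals \<open>x\<close>.
\<close>
lemma dilog_pair_args:
  assumes "Re c < 1"
  shows "(1 - \<i>) / 2 * (1 + \<i> * c) \<in> slit_plane" "(1 + \<i>) / 2 * (1 - \<i> * c) \<in> slit_plane"
  using assms by (auto simp: mem_slit_plane field_simps)

text \<open>
  The argument of \<open>z\<close> lies in \<open>(-pi/2, pi/2)\<close>, so a rotation by \<open>\<plusminus>pi/4\<close> stays within the
  principal branch.
\<close>
lemma Ln_rotated:
  assumes "Re z > 0"
  shows "Ln ((1 + \<i>) / 2 * z) = Ln z - of_real (ln 2 / 2) + \<i> * of_real (pi / 4)"
    and "Ln ((1 - \<i>) / 2 * z) = Ln z - of_real (ln 2 / 2) - \<i> * of_real (pi / 4)"
proof -
  have z: "z \<noteq> 0" using assms by auto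
  have im: "\<bar>Im (Ln z)\<bar> < pi / 2" using assms Re_Ln_pos_lt z by blast
  have s2: "exp (complex_of_real (ln 2 / 2)) = of_real (sqrt 2)"
    unfolding exp_of_real by (simp add: powr_def flip: powr_half_sqrt)
  have e1: "exp (\<i> * of_real (pi / 4)) = (1 + \<i>) * of_real (sqrt 2 / 2)"
    by (simp add: complex_eq_iff Re_exp Im_exp cos_45 sin_45)
  have e2: "exp (- (\<i> * of_real (pi / 4))) = (1 - \<i>) * of_real (sqrt 2 / 2)"
    by (simp add: complex_eq_iff Re_exp Im_exp cos_45 sin_45)
  have "Ln (exp (Ln z - of_real (ln 2 / 2) + \<i> * of_real (pi / 4))) = Ln z - of_real (ln 2 / 2) + \<i> * of_real (pi / 4)"
    by (rule Ln_exp) (use im in auto)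
  moreover have "exp (Ln z - of_real (ln 2 / 2) + \<i> * of_real (pi / 4)) = (1 + \<i>) / 2 * z"
    unfolding exp_add exp_diff s2 e1 using z by (simp add: field_simps)
  ultimately show "Ln ((1 + \<i>) / 2 * z) = Ln z - of_real (ln 2 / 2) + \<i> * of_real (pi / 4)" by (simp only:)
  have "Ln (exp (Ln z - of_real (ln 2 / 2) + - (\<i> * of_real (pi / 4)))) = Ln z - of_real (ln 2 / 2) + - (\<i> * of_real (pi / 4))"
    by (rule Ln_exp) (use im in auto)
  moreover have "exp (Ln z - of_real (ln 2 / 2) + - (\<i> * of_real (pi / 4))) = (1 - \<i>) / 2 * z"
    unfolding exp_add exp_diff s2 e2 using z by (simp add: field_simps)
  ultimately show "Ln ((1 - \<i>) / 2 * z) = Ln z - of_real (ln 2 / 2) - \<i> * of_real (pi / 4)" by (simp only: add_uminus_conv_diff)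
qed

text \<open>
  With \<open>z\<close> and \<open>w\<close> the two arguments, \<open>1 - z\<close> and \<open>1 - w\<close> are rotations of \<open>(1 - c)/sqrt 2\<close> by
  \<open>pi/4\<close> in opposite directions. In the derivative of
  the difference, the common part of the
  logarithms collects \<open>1/(1 + \<i>c) + 1/(1 - \<i>c) = 2/(1 + c\<^sup>2)\<close> and the parts \<open>\<plusminus>\<i>pi/4\<close> collect
  \<open>1/(1 + \<i>c) - 1/(1 - \<i>c) = -2\<i>c/(1 + c\<^sup>2)\<close>.
\<close>
lemma dilog_pair_has_field_derivative:
  assumes "Re c < 1" "1 + c\<^sup>2 \<noteq> 0"
  shows "(dilog_pair has_field_derivative
    - 2 * \<i> * ((Ln (1 - c) - of_real (ln 2 / 2) + c * of_real (pi / 4)) / (1 + c\<^sup>2))) (at c)"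
proof -
  have fac: "1 + c\<^sup>2 = (1 + \<i> * c) * (1 - \<i> * c)"
    by (simp add: algebra_simps power2_eq_square)
  then have nz: "1 + \<i> * c \<noteq> 0" "1 - \<i> * c \<noteq> 0"
    using assms(2) by auto
  define z w where "z = (1 - \<i>) / 2 * (1 + \<i> * c)" and "w = (1 + \<i>) / 2 * (1 - \<i> * c)"
  define L where "L = Ln (1 - c) - of_real (ln 2 / 2)"
  have i: "(1::complex) - \<i> \<noteq> 0" "(1::complex) + \<i> \<noteq> 0" by (auto simp: complex_eq_iff)
  have nz': "z \<noteq> 0" "w \<noteq> 0" using nz i by (auto simp: z_def w_def)
  have "1 - z = (1 + \<i>) / 2 * (1 - c)" "1 - w = (1 - \<i>) / 2 * (1 - c)"
    by (auto simp: z_def w_def field_simps)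
  then have Ln: "Ln (1 - z) = L + \<i> * of_real (pi / 4)" "Ln (1 - w) = L - \<i> * of_real (pi / 4)"
    using Ln_rotated[of "1 - c"] assms by (simp_all only: L_def minus_complex.sel one_complex.sel diff_gt_0_iff_gt)
  have 1: "((\<lambda>c. Li\<^sub>2 ((1 - \<i>) / 2 * (1 + \<i> * c))) has_field_derivative
        - Ln (1 - z) / z * ((1 - \<i>) / 2 * \<i>)) (at c)"
    unfolding z_def
    by (rule has_field_derivative_Li2_compose)
       (use dilog_pair_args[OF assms(1)] nz' in \<open>auto simp: z_def intro!: derivative_eq_intros\<close>)
  have 2: "((\<lambda>c. Li\<^sub>2 ((1 + \<i>) / 2 * (1 - \<i> * c))) has_field_derivative
        - Ln (1 - w) / w * ((1 + \<i>) / 2 * - \<i>)) (at c)"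
    unfolding w_def
    by (rule has_field_derivative_Li2_compose)
       (use dilog_pair_args[OF assms(1)] nz' in \<open>auto simp: w_def intro!: derivative_eq_intros\<close>)
  have cancel: "- l / (k * u) * (k * e) = - e * l / u" if "k \<noteq> 0" for k l u e :: complex
    using that by (cases "u = 0") (simp_all add: divide_simps)
  have "- Ln (1 - z) / z * ((1 - \<i>) / 2 * \<i>) = - \<i> * (L + \<i> * of_real (pi / 4)) / (1 + \<i> * c)"
    unfolding Ln unfolding z_def by (subst cancel) (use i in auto)
  moreover have "- Ln (1 - w) / w * ((1 + \<i>) / 2 * - \<i>) = \<i> * (L - \<i> * of_real (pi / 4)) / (1 - \<i> * c)"
    unfolding Ln unfolding w_def by (subst cancel) (use i in auto)
  moreover have "- \<i> * (L + \<i> * of_real (pi / 4)) / (1 + \<i> * c) - \<i> * (L - \<i> * of_real (pi / 4)) / (1 - \<i> * c)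
     = - 2 * \<i> * ((L + c * of_real (pi / 4)) / (1 + c\<^sup>2))"
  proof -
    have "- \<i> * (L + \<i> * p) / (1 + \<i> * c) - \<i> * (L - \<i> * p) / (1 - \<i> * c) = - 2 * \<i> * ((L + c * p) / (1 + c\<^sup>2))" for p
      unfolding fac using nz by (simp add: divide_simps) (simp add: algebra_simps)
    then show ?thesis .
  qed
  ultimately show ?thesis
    using DERIV_diff[OF 1 2] by (simp add: dilog_pair_def[abs_def] L_def)
qed

text \<open>
  Both sides have the same derivative in the parameter except at \<open>\<plusminus>\<i>\<close>, where the formulas for
  the derivatives degenerate. Continuity bridges these two points. They cannot be left out of the
  parameter domain: for odd \<open>n\<close> they occur among the \<open>n\<close>-th roots of \<open>\<plusminus>\<i>\<close>.
\<close>
lemma log_integral_diff_eq_dilog_pair: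
  assumes "Re a < 1" "Re b < 1"
  shows "log_integral b - log_integral a = \<i> / 2 * (dilog_pair b - dilog_pair a)"
proof -
  let ?H = "{c. Re c < 1}" and ?F = "\<lambda>c. log_integral c - \<i> / 2 * dilog_pair c"
  have "?F constant_on ?H"
  proof (rule DERIV_zero_connected_constant_on[where K = "{\<i>, - \<i>}"])
    show "connected ?H" using convex_halfspace_Re_lt convex_connected by blast
    show "open ?H" by (rule open_halfspace_Re_lt)
    have "continuous_on ?H log_integral"
      using log_integral_has_field_derivative
      by (intro continuous_at_imp_continuous_on) (auto intro: DERIV_isCont)
    moreover have "continuous_on ?H dilog_pair"
      unfolding dilog_pair_def
      by (intro continuous_intros continuous_on_compose2[OF holomorphic_on_imp_continuous_on[OF holomorphic_Li2]])
         (use dilog_pair_args in \<open>auto\<close>)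
    ultimately show "continuous_on ?H ?F" by (intro continuous_intros)
    show "\<forall>c\<in>?H - {\<i>, - \<i>}. (?F has_field_derivative 0) (at c)"
    proof
      fix c assume c: "c \<in> ?H - {\<i>, - \<i>}"
      have "1 + c\<^sup>2 = (c - \<i>) * (c + \<i>)" by (simp add: algebra_simps power2_eq_square)
      then have nz: "1 + c\<^sup>2 \<noteq> 0" using c by (auto simp: eq_neg_iff_add_eq_0)
      let ?D = "(Ln (1 - c) - of_real (ln 2 / 2) + c * of_real (pi / 4)) / (1 + c\<^sup>2)"
      have "(?F has_field_derivative ?D - \<i> / 2 * (- 2 * \<i> * ?D)) (at c)"
        using log_integral_has_field_derivative[of c] integral_log_integrand_deriv[OF _ nz] c
        by (intro DERIV_diff DERIV_cmult dilog_pair_has_field_derivative nz) auto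
      moreover have "\<i> / 2 * (- 2 * \<i> * D) = D" for D by simp
      ultimately show "(?F has_field_derivative 0) (at c)" by (simp only: diff_self)
    qed
  qed simp
  then have "?F b = ?F a" using assms by (auto simp: constant_on_def)
  then show ?thesis unfolding right_diff_distrib by (simp only: diff_eq_eq eq_diff_eq) (simp add: algebra_simps)
qed

section \<open>Roots of \<open>\<plusminus>\<i>\<close>\<close>

text \<open>
  The \<open>c j\<close> are the \<open>n\<close>-th roots of \<open>c0 ^ n\<close>, so the sum is minus the logarithmic derivative of
  \<open>1 - c0 ^ n * z ^ n\<close>, the product of the \<open>1 - c j * z\<close>. It is computed without the factorization:
  a finite geometric series writes each summand as a polynomial in \<open>z\<close> over the common denominator
  \<open>1 - c0 ^ n * z ^ n\<close>, and among the power sums of the roots of orders 1 to \<open>n\<close> only the \<open>n\<close>-th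
  survives.
\<close>
lemma sum_roots_partial_fractions:
  fixes c0 z :: complex
  assumes "n > 0" and c: "\<And>j. c j = c0 * exp (2 * of_real pi * \<i> * of_nat j / of_nat n)"
    and nz: "c0 ^ n * z ^ n \<noteq> 1"
  shows "(\<Sum>j=1..n. c j / (1 - c j * z)) = of_nat n * c0 ^ n * z ^ (n - 1) / (1 - c0 ^ n * z ^ n)"
proof -
  have cn: "c j ^ n = c0 ^ n" for j
    using complex_root_unity[of n j] assms(1) by (simp add: c power_mult_distrib)
  have power_sum: "(\<Sum>j=1..n. c j ^ Suc k) = (if k = n - 1 then of_nat n * c0 ^ n else 0)" if "k < n" for k
  proof (cases "k = n - 1")
    case True
    then show ?thesis using assms(1) cn by simp
  next
    case False
    define w where "w = exp (2 * of_real pi * \<i> * of_nat (Suc k) / of_nat n)"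
    have "\<not> n dvd Suc k" using that False by (auto dest: dvd_imp_le)
    then have "w \<noteq> 1" using complex_root_unity_eq_1[of n "Suc k"] assms(1) by (simp add: w_def del: of_nat_Suc)
    moreover have "w ^ n = 1" using complex_root_unity[of n "Suc k"] assms(1) by (simp add: w_def del: of_nat_Suc)
    moreover have "c j ^ Suc k = c0 ^ Suc k * w ^ j" for j
      unfolding c w_def power_mult_distrib exp_of_nat_mult[symmetric]
      by (simp add: mult_ac del: of_nat_Suc power_Suc)
    moreover have "(\<Sum>j=1..n. w ^ j) = w * (\<Sum>j<n. w ^ j)"
      unfolding sum_distrib_left by (rule sum.reindex_bij_witness[of _ Suc "\<lambda>j. j - 1"]) (auto simp flip: power_Suc)
    ultimately have "(\<Sum>j=1..n. c j ^ Suc k) = c0 ^ Suc k * (w * (\<Sum>j<n. w ^ j))" "(\<Sum>j<n. w ^ j) = 0"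
      by (simp_all only: sum_distrib_left[symmetric] sum_gp_strict) simp_all
    then show ?thesis using False by simp
  qed
  have "c j / (1 - c j * z) = (\<Sum>k<n. c j ^ Suc k * z ^ k) / (1 - c0 ^ n * z ^ n)" for j
  proof -
    let ?S = "\<Sum>k<n. (c j * z) ^ k"
    have geo: "(1 - c j * z) * ?S = 1 - c0 ^ n * z ^ n"
      using one_diff_power_eq[of "c j * z" n] by (simp add: power_mult_distrib cn)
    then have "?S \<noteq> 0" using nz by auto
    then have "c j / (1 - c j * z) = c j * ?S / ((1 - c j * z) * ?S)" by simp
    moreover have "(\<Sum>k<n. c j ^ Suc k * z ^ k) = c j * ?S"
      by (simp add: sum_distrib_left power_mult_distrib mult_ac)
    ultimately show ?thesis by (simp only: geo)
  qed
  then have "(\<Sum>j=1..n. c j / (1 - c j * z)) = (\<Sum>j=1..n. \<Sum>k<n. c j ^ Suc k * z ^ k) / (1 - c0 ^ n * z ^ n)"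
    by (simp add: sum_divide_distrib)
  also have "(\<Sum>j=1..n. \<Sum>k<n. c j ^ Suc k * z ^ k) = (\<Sum>k<n. (\<Sum>j=1..n. c j ^ Suc k) * z ^ k)"
    by (subst sum.swap) (simp add: sum_distrib_right)
  also have "\<dots> = (\<Sum>k<n. if k = n - 1 then of_nat n * c0 ^ n * z ^ (n - 1) else 0)"
    by (intro sum.cong) (use power_sum in auto)
  also have "\<dots> = of_nat n * c0 ^ n * z ^ (n - 1)"
    using assms(1) by simp
  finally show ?thesis .
qed

text \<open>
  For \<open>s = 1\<close> and \<open>s = -1\<close> these are, as \<open>j\<close> varies, the \<open>n\<close>-th roots of \<open>\<i>\<close> and of \<open>-\<i>\<close>.
\<close>
definition quarter_root :: "nat \<Rightarrow> complex \<Rightarrow> nat \<Rightarrow> complex" where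
  "quarter_root n s j = exp (of_real pi * \<i> / (2 * of_nat n) * (4 * of_nat j + s))"

lemma quarter_root_eq:
  "quarter_root n s j = quarter_root n s 0 * exp (2 * of_real pi * \<i> * of_nat j / of_nat n)"
  unfolding quarter_root_def exp_add[symmetric] by (cases "n = 0") (auto simp: field_simps)

lemma quarter_root_power:
  assumes "n > 0"
  shows "quarter_root n 1 j ^ n = \<i>" "quarter_root n (-1) j ^ n = - \<i>"
proof -
  have "quarter_root n s j ^ n = exp (of_real pi * \<i> / 2 * s) * exp (2 * of_real pi * \<i> * of_nat j / of_nat 1)" for s
    unfolding quarter_root_def exp_of_nat_mult[symmetric] exp_add[symmetric] 
    using assms by (intro arg_cong[where f = exp]) (simp add: field_simps)
  moreover have "exp (2 * of_real pi * \<i> * of_nat j / of_nat 1) = 1"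
    using complex_root_unity_eq_1[of 1 j] by simp
  moreover have "exp (of_real pi * \<i> / 2) = \<i>" "exp (- (of_real pi * \<i> / 2)) = - \<i>"
    by (simp_all add: complex_eq_iff Re_exp Im_exp)
  ultimately show "quarter_root n 1 j ^ n = \<i>" "quarter_root n (-1) j ^ n = - \<i>"
    by simp_all
qed

lemma Re_less_1_of_norm_1:
  assumes "cmod c = 1" "c \<noteq> 1"
  shows "Re c < 1"
proof (rule ccontr)
  assume "\<not> Re c < 1"
  then have "Re c = 1" using complex_Re_le_cmod[of c] assms by simp
  moreover have "(Re c)\<^sup>2 + (Im c)\<^sup>2 = 1" using assms cmod_power2[of c] by simp
  ultimately show False using assms by (simp add: complex_eq_iff)
qed

lemma Re_quarter_root_less_1:
  assumes "n > 0"
  shows "Re (quarter_root n 1 j) < 1" "Re (quarter_root n (-1) j) < 1"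
proof -
  have i: "\<i> \<noteq> 1" "- \<i> \<noteq> 1" by (auto simp: complex_eq_iff)
  have "quarter_root n 1 j \<noteq> 1" "quarter_root n (-1) j \<noteq> 1"
    using quarter_root_power[OF assms, of j] i by (metis power_one)+
  moreover have "cmod (quarter_root n 1 j) = 1" "cmod (quarter_root n (-1) j) = 1"
    by (simp_all add: quarter_root_def)
  ultimately show "Re (quarter_root n 1 j) < 1" "Re (quarter_root n (-1) j) < 1"
    using Re_less_1_of_norm_1 by blast+
qed

text \<open>
  Comparing derivatives on \<open>[0, 1]\<close> instead of taking the logarithm of a product shows that the
  principal logarithms add up without a multiple of \<open>2 pi \<i>\<close>: both sides vanish at 0.
\<close>
lemma arctan_power_eq_sum_Ln:
  assumes "n > 0" "t \<in> {0..1}"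
  shows "(\<Sum>j=1..n. Ln (1 - quarter_root n (-1) j * of_real t) - Ln (1 - quarter_root n 1 j * of_real t))
    = 2 * \<i> * of_real (arctan (t ^ n))"
proof -
  let ?a = "quarter_root n 1" and ?b = "quarter_root n (-1)"
  define F where "F t = (\<Sum>j=1..n. Ln (1 - ?b j * of_real t) - Ln (1 - ?a j * of_real t))
    - 2 * \<i> * of_real (arctan (t ^ n))" for t :: real
  obtain k where "\<And>x. x \<in> {0..1} \<Longrightarrow> F x = k"
  proof (rule has_vector_derivative_zero_constant[of "{0..1}" F])
    fix s :: real assume s: "s \<in> {0..1}"
    let ?z = "complex_of_real (s ^ n)"
    have nz: "1 - \<i> * ?z \<noteq> 0" "1 + \<i> * ?z \<noteq> 0" "1 + ?z\<^sup>2 \<noteq> 0"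
      using one_plus_square_nonzero[of "s ^ n"] by (auto simp: complex_eq_iff)
    have D: "(F has_vector_derivative
        (\<Sum>j=1..n. - ?b j / (1 - ?b j * of_real s) - - ?a j / (1 - ?a j * of_real s))
        - 2 * \<i> * of_real (real n * s ^ (n - 1) / (1 + (s ^ n)\<^sup>2))) (at s within {0..1})"
      unfolding F_def
      by (intro has_vector_derivative_diff has_vector_derivative_sum Ln_has_vector_derivative
            has_vector_derivative_mult_right has_vector_derivative_of_real Re_quarter_root_less_1 assms s)
         (auto intro!: derivative_eq_intros simp: field_simps)
    have a: "(\<Sum>j=1..n. ?a j / (1 - ?a j * of_real s)) = of_nat n * \<i> * of_real s ^ (n - 1) / (1 - \<i> * ?z)"
      using sum_roots_partial_fractions[OF assms(1) quarter_root_eq[of n 1], of "of_real s"] quarter_root_power[OF assms(1)] nz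
      by simp
    have b: "(\<Sum>j=1..n. ?b j / (1 - ?b j * of_real s)) = - (of_nat n * \<i> * of_real s ^ (n - 1)) / (1 + \<i> * ?z)"
      using sum_roots_partial_fractions[OF assms(1) quarter_root_eq[of n "-1"], of "of_real s"] quarter_root_power[OF assms(1)] nz
      by (simp add: add_eq_0_iff2)
    have "(\<Sum>j=1..n. - ?b j / (1 - ?b j * of_real s) - - ?a j / (1 - ?a j * of_real s))
       = (\<Sum>j=1..n. ?a j / (1 - ?a j * of_real s)) - (\<Sum>j=1..n. ?b j / (1 - ?b j * of_real s))"
      by (simp add: sum_subtractf sum_negf sum.distrib)
    also have "\<dots> = 2 * \<i> * (of_nat n * of_real s ^ (n - 1) / (1 + ?z\<^sup>2))"
    proof -
      have "q * \<i> * p / (1 - \<i> * z) - - (q * \<i> * p) / (1 + \<i> * z) = 2 * \<i> * (q * p / (1 + z\<^sup>2))"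
        if "1 - \<i> * z \<noteq> 0" "1 + \<i> * z \<noteq> 0" for p q z
      proof -
        have "1 + z\<^sup>2 = (1 - \<i> * z) * (1 + \<i> * z)" by (simp add: algebra_simps power2_eq_square)
        then show ?thesis using that by (simp add: divide_simps) (simp add: algebra_simps)
      qed
      then show ?thesis unfolding a b using nz by blast
    qed
    finally show "(F has_vector_derivative 0) (at s within {0..1})"
      using D by simp
  qed simp_all
  from this[of t] this[of 0] have "F t = F 0" using assms by simp
  then show ?thesis using assms by (simp add: F_def zero_power)
qed

section \<open>The values of \<open>T\<close> at \<open>n\<close> and \<open>1/n\<close>\<close>

lemma henstock_integral_complex_of_real:
  "integral S (\<lambda>x. complex_of_real (f x)) = of_real (integral S f)"
proof (cases "f integrable_on S")
  case True
  then show ?thesis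
    using has_integral_of_real[of f] by (metis has_integral_integral integral_unique)
next
  case False
  then have "\<not> (\<lambda>x. complex_of_real (f x)) integrable_on S"
    using integrable_linear[OF _ bounded_linear_Re, of "\<lambda>x. complex_of_real (f x)" S] by (auto simp: o_def)
  then show ?thesis using False by (simp add: not_integrable_integral)
qed

lemma T_of_nat:
  assumes "n > 0"
  shows "T (of_nat n) = of_real (integral {0..1} (\<lambda>t. arctan (t ^ n) / (1 + t\<^sup>2)))"
proof -
  have "T (of_nat n) = integral {0..1} (\<lambda>t. complex_of_real (arctan (t ^ n) / (1 + t\<^sup>2)))"
    unfolding T_def
  proof (rule integral_cong)
    fix t :: real
    have "complex_of_real t powr of_nat n = of_real (t ^ n)"
      using assms by (simp add: powr_nat')
    then show "Arctan (complex_of_real t powr of_nat n) / of_real (1 + t\<^sup>2) = of_real (arctan (t ^ n) / (1 + t\<^sup>2))"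
      by (simp only: Arctan_of_real of_real_divide)
  qed
  then show ?thesis by (simp only: henstock_integral_complex_of_real)
qed

lemma T_inverse_nat:
  assumes "n > 0"
  shows "T (1 / of_nat n) = of_real (integral {0..1} (\<lambda>t. arctan (root n t) / (1 + t\<^sup>2)))"
proof -
  have "T (1 / of_nat n) = integral {0..1} (\<lambda>t. complex_of_real (arctan (root n t) / (1 + t\<^sup>2)))"
    unfolding T_def
  proof (rule integral_cong)
    fix t :: real assume t: "t \<in> {0..1}"
    have "complex_of_real t powr (1 / of_nat n) = of_real (t powr (1 / real n))"
      using t powr_of_real[of t "1 / real n"] by simp
    also have "t powr (1 / real n) = root n t"
      using t assms by (cases "t = 0") (auto simp: root_powr_inverse)
    finally show "Arctan (complex_of_real t powr (1 / of_nat n)) / of_real (1 + t\<^sup>2) = of_real (arctan (root n t) / (1 + t\<^sup>2))"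
      by (simp only: Arctan_of_real of_real_divide)
  qed
  then show ?thesis by (simp only: henstock_integral_complex_of_real)
qed

text \<open>
  The substitution \<open>t = s\<^sup>n\<close> turns the second integral into that of \<open>arctan s\<close> against the
  differential of \<open>arctan (s\<^sup>n)\<close>, and the first is the integral of \<open>arctan (s\<^sup>n)\<close> against the
  differential of \<open>arctan s\<close>. Their sum is the increment \<open>(pi/4)\<^sup>2\<close> of the product.
\<close>
lemma T_reflection:
  assumes "n > 0"
  shows "T (of_nat n) + T (1 / of_nat n) = of_real pi ^ 2 / 16"
proof -
  define f where "f t = arctan (t ^ n) / (1 + t\<^sup>2)" for t :: real
  define g where "g t = arctan (root n t) / (1 + t\<^sup>2)" for t :: real
  have sq: "1 + t\<^sup>2 \<noteq> 0" for t :: real using power2_less_0[of t] by (smt (verit))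
  have cf: "continuous_on {0..1} f" and cg: "continuous_on {0..1} g"
    unfolding f_def g_def using sq by (auto intro!: continuous_intros)
  \<comment> \<open>Variable upper limits do substitution and integration by parts in one step, and the root,
    which is not differentiable at 0, never has to be differentiated.\<close>
  define H where "H s = integral {0..s} f + integral {0..s ^ n} g - arctan s * arctan (s ^ n)" for s :: real
  have If: "((\<lambda>x. integral {0..x} f) has_real_derivative f s) (at s within {0..1})" if "s \<in> {0..1}" for s
    using integral_has_real_derivative[OF cf that] .
  have Ig: "((\<lambda>x. integral {0..x} g) has_real_derivative g s) (at s within {0..1})" if "s \<in> {0..1}" for s
    using integral_has_real_derivative[OF cg that] .
  have pw: "s ^ n \<in> {0..1}" if "s \<in> {0..1}" for s :: real
    using that by (auto simp: power_le_one)
  have "H 1 = H 0"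
  proof (rule DERIV_isconst_end[of 0 1 H])
    have c1: "continuous_on {0..1} (\<lambda>x. integral {0..x} f)" "continuous_on {0..1} (\<lambda>x. integral {0..x} g)"
      using DERIV_continuous_on[OF If] DERIV_continuous_on[OF Ig] by blast+
    have "continuous_on {0..1} (\<lambda>s::real. integral {0..s ^ n} g)"
      by (rule continuous_on_compose2[OF c1(2)]) (use pw in \<open>auto intro!: continuous_intros\<close>)
    with c1 show "continuous_on {0..1} H"
      unfolding H_def by (auto intro!: continuous_intros)
    fix s :: real assume s: "0 < s" "s < 1"
    have sn: "0 < s ^ n" "s ^ n < 1" using s assms by (auto simp: power_less_one_iff)
    have at: "at x within {0..1} = at x" if "0 < x" "x < 1" for x :: real
      using that by (intro at_within_interior) auto
    have df: "((\<lambda>x. integral {0..x} f) has_real_derivative f s) (at s)"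
      using If[of s] s at[of s] by auto
    have dg: "((\<lambda>x. integral {0..x} g) has_real_derivative g (s ^ n)) (at (s ^ n))"
      using Ig[of "s ^ n"] sn at[of "s ^ n"] by auto
    have "((\<lambda>s. integral {0..s ^ n} g) has_real_derivative g (s ^ n) * (real n * s ^ (n - 1))) (at s)"
      by (rule DERIV_chain2[where f = "\<lambda>x. integral {0..x} g" and g = "\<lambda>s. s ^ n", OF dg]) (auto intro!: derivative_eq_intros)
    moreover have "((\<lambda>s. arctan s * arctan (s ^ n)) has_real_derivative 
        arctan (s ^ n) / (1 + s\<^sup>2) + arctan s / (1 + (s ^ n)\<^sup>2) * (real n * s ^ (n - 1))) (at s)"
      using sq[of s] sq[of "s ^ n"] by (auto intro!: derivative_eq_intros simp: field_simps)
    moreover have "root n (s ^ n) = s" using s assms by (simp add: real_root_power_cancel)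
    ultimately show "(H has_real_derivative 0) (at s)"
      unfolding H_def by (auto intro!: derivative_eq_intros df simp: f_def g_def divide_inverse mult_ac)
  qed simp
  then have "integral {0..1} f + integral {0..1} g = (pi / 4)\<^sup>2"
    using assms by (simp add: H_def arctan_one power2_eq_square zero_power)
  then have "complex_of_real (integral {0..1} f + integral {0..1} g) = of_real ((pi / 4)\<^sup>2)"
    by (simp only:)
  then show ?thesis
    unfolding T_of_nat[OF assms] T_inverse_nat[OF assms] f_def[abs_def] g_def[abs_def]
    by (simp add: power_divide)
qed

lemma T_of_nat_eq_dilog:
  assumes "n > 0"
  shows "T (of_nat n) = 1 / 4 * (\<Sum>j=1..n. dilog_pair (quarter_root n (-1) j) - dilog_pair (quarter_root n 1 j))"
proof -
  let ?a = "quarter_root n 1" and ?b = "quarter_root n (-1)"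
  let ?L = "\<lambda>c t. Ln (1 - c * of_real t) / complex_of_real (1 + t\<^sup>2)"
  have int: "?L (?a j) integrable_on {0..1}" "?L (?b j) integrable_on {0..1}" for j
    using log_integrand_integrable Re_quarter_root_less_1[OF assms] by blast+
  have "2 * \<i> * T (of_nat n) = integral {0..1} (\<lambda>t. 2 * \<i> * of_real (arctan (t ^ n) / (1 + t\<^sup>2)))"
    unfolding T_of_nat[OF assms] by (simp only: integral_mult_right henstock_integral_complex_of_real)
  also have "\<dots> = integral {0..1} (\<lambda>t. \<Sum>j=1..n. ?L (?b j) t - ?L (?a j) t)"
  proof (rule integral_cong)
    fix t :: real assume "t \<in> {0..1}"
    then have "2 * \<i> * of_real (arctan (t ^ n)) / complex_of_real (1 + t\<^sup>2)
       = (\<Sum>j=1..n. Ln (1 - ?b j * of_real t) - Ln (1 - ?a j * of_real t)) / of_real (1 + t\<^sup>2)"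
      using arctan_power_eq_sum_Ln[OF assms] by simp
    then show "2 * \<i> * of_real (arctan (t ^ n) / (1 + t\<^sup>2)) = (\<Sum>j=1..n. ?L (?b j) t - ?L (?a j) t)"
      by (simp add: sum_divide_distrib diff_divide_distrib)
  qed
  also have "\<dots> = (\<Sum>j=1..n. integral {0..1} (\<lambda>t. ?L (?b j) t - ?L (?a j) t))"
    by (rule integral_sum) (intro finite_atLeastAtMost integrable_diff int)+
  also have "\<dots> = (\<Sum>j=1..n. log_integral (?b j) - log_integral (?a j))"
    unfolding log_integral_def by (simp only: integral_diff[OF int(2) int(1)])
  also have "\<dots> = (\<Sum>j=1..n. \<i> / 2 * (dilog_pair (?b j) - dilog_pair (?a j)))"
    by (intro sum.cong refl log_integral_diff_eq_dilog_pair Re_quarter_root_less_1 assms)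
  finally have "2 * \<i> * T (of_nat n) = \<i> / 2 * (\<Sum>j=1..n. dilog_pair (?b j) - dilog_pair (?a j))"
    by (simp only: sum_distrib_left)
  then have "2 * \<i> * T (of_nat n) = 2 * \<i> * (1 / 4 * (\<Sum>j=1..n. dilog_pair (?b j) - dilog_pair (?a j)))"
    by simp
  then show ?thesis by (simp only: mult_cancel_left) simp
qed

lemma exp_eq_quarter_root:
  assumes "n > 0"
  shows "exp (of_real pi * \<i> / (2 * of_nat n) * (4 * of_nat j + of_nat n + s)) = \<i> * quarter_root n s j"
proof -
  have "exp (of_real pi * \<i> / (2 * of_nat n) * (4 * of_nat j + of_nat n + s)) 
      = exp (of_real pi * \<i> / 2 + of_real pi * \<i> / (2 * of_nat n) * (4 * of_nat j + s))"
    using assms by (intro arg_cong[where f = exp]) (simp add: field_simps)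
  also have "\<dots> = exp (of_real pi * \<i> / 2) * quarter_root n s j"
    unfolding exp_add quarter_root_def ..
  also have "exp (of_real pi * \<i> / 2) = \<i>" by (simp add: complex_eq_iff Re_exp Im_exp)
  finally show ?thesis .
qed

theorem corollary4p4:
  fixes n :: nat
  assumes "n \<ge> 1"
  shows "T (of_nat n) =
      1 / 4 * (\<Sum>j=1..n.
          Li\<^sub>2 ((1 + \<i>) / 2 * (1 - exp (of_real pi * \<i> / (2 * of_nat n) * (4 * of_nat j + of_nat n + 1))))
        + Li\<^sub>2 ((1 - \<i>) / 2 * (1 + exp (of_real pi * \<i> / (2 * of_nat n) * (4 * of_nat j + of_nat n - 1))))
        - Li\<^sub>2 ((1 - \<i>) / 2 * (1 + exp (of_real pi * \<i> / (2 * of_nat n) * (4 * of_nat j + of_nat n + 1))))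
        - Li\<^sub>2 ((1 + \<i>) / 2 * (1 - exp (of_real pi * \<i> / (2 * of_nat n) * (4 * of_nat j + of_nat n - 1)))))
    \<and> T (1 / of_nat n) =
      of_real pi ^ 2 / 16 - 1 / 4 * (\<Sum>j=1..n.
          Li\<^sub>2 ((1 + \<i>) / 2 * (1 - exp (of_real pi * \<i> / (2 * of_nat n) * (4 * of_nat j + of_nat n + 1))))
        + Li\<^sub>2 ((1 - \<i>) / 2 * (1 + exp (of_real pi * \<i> / (2 * of_nat n) * (4 * of_nat j + of_nat n - 1))))
        - Li\<^sub>2 ((1 - \<i>) / 2 * (1 + exp (of_real pi * \<i> / (2 * of_nat n) * (4 * of_nat j + of_nat n + 1))))
        - Li\<^sub>2 ((1 + \<i>) / 2 * (1 - exp (of_real pi * \<i> / (2 * of_nat n) * (4 * of_nat j + of_nat n - 1)))))"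
    (is "_ = 1 / 4 * ?S \<and> _ = _ - 1 / 4 * ?S")
proof -
  have n: "n > 0" using assms by simp
  have "?S = (\<Sum>j=1..n. dilog_pair (quarter_root n (-1) j) - dilog_pair (quarter_root n 1 j))"
    using exp_eq_quarter_root[OF n, where s = 1] exp_eq_quarter_root[OF n, where s = "-1"]
    by (intro sum.cong) (simp_all add: dilog_pair_def)
  then have "T (of_nat n) = 1 / 4 * ?S"
    using T_of_nat_eq_dilog[OF n] by (simp only:)
  moreover have "T (1 / of_nat n) = of_real pi ^ 2 / 16 - T (of_nat n)"
    using T_reflection[OF n] by (simp add: eq_diff_eq add.commute)
  ultimately show ?thesis by (intro conjI) (simp_all only:)
qed

end
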